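(* Let $k$ be a field of characteristic zero, $R=k[x_1,\ldots,x_n]$, and let $\mathbf f=f_1,\ldots,f_m\in R$ be forms, not necessarily of the same degree. Set $d_j=\deg(f_j)$ for $1\le j\le m$ and $\tilde{\mathbf f}=\{d_1f_1,\ldots,d_mf_m\}$. There is an exact sequence of $R$-modules $$0\to\mathfrak{Z}\to Z(\tilde{\mathbf f})\stackrel{\mathfrak{j}}{\longrightarrow}\mathcal{D}(\mathbf f)\cap Z(\mathbf x)\to 0,$$ where $\mathfrak{j}$ sends a syzygy $(g_1,\ldots,g_m)$ of $\tilde{\mathbf f}$ to the element $\sum_{j=1}^m g_j\,df_j$. In particular, if $\mathbf f$ is polarizable then there is an exact sequence of $R$-modules $$0\to\mathfrak{D}\to Z(\tilde{\mathbf f})\to\mathcal{D}(\mathbf f)\cap Z(\mathbf x)\to 0.$$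
   Context: For a finite sequence $\mathbf h$ of elements of $R$, $Z(\mathbf h)$ denotes its first syzygy module. $Z(\tilde{\mathbf f})$ is regarded as a submodule of the free $R$-module $\sum_{j=1}^m R\,dT_j\simeq R^m$ with basis $dT_1,\ldots,dT_m$, and $Z(\mathbf x)$, where $\mathbf x=x_1,\ldots,x_n$, as a submodule of the free $R$-module $\sum_{i=1}^n R\,dx_i$ (the kernel of $dx_i\mapsto x_i$). For $f\in R$ put $df=\sum_{i=1}^n\frac{\partial f}{\partial x_i}dx_i$. The transposed Jacobian module is $\mathcal{D}(\mathbf f)=\sum_{j=1}^m R\,df_j\subset\sum_{i=1}^n R\,dx_i$. The differential syzygy module $\mathfrak{Z}$ is the kernel of the $R$-linear map $\sum_{j=1}^m R\,dT_j\to\mathcal{D}(\mathbf f)$, $dT_j\mapsto df_j$. Let $P$ be the kernel of $k[T_1,\ldots,T_m]\to R$, $T_j\mapsto f_j$. The polar syzygy module $\mathfrak{D}\subset\mathfrak{Z}$ is the $R$-submodule of $\sum_j R\,dT_j$ generated by the vectors $\sum_{j=1}^m\frac{\partial F}{\partial T_j}(\mathbf f)\,dT_j$, $F\in P$. $\mathbf f$ is polarizable if $\mathfrak{D}=\mathfrak{Z}$. *)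

theory Defs
  imports "HOL-Analysis.Finite_Cartesian_Product" "HOL-Library.Poly_Mapping"
begin

subsection \<open>Polynomials\<close>

text \<open>The polynomial ring over \<^typ>\<open>'k\<close> in a finite family of indeterminates indexed by the type
  \<^typ>\<open>'v\<close>: finitely supported maps from exponent vectors to coefficients, with the convolution
  product. Both $k[x_1,\dots,x_n]$ and $k[T_1,\dots,T_m]$ are instances.\<close>

type_synonym ('v, 'k) mpol = "('v \<Rightarrow>\<^sub>0 nat) \<Rightarrow>\<^sub>0 'k"

definition Const :: "'k::comm_ring_1 \<Rightarrow> ('v::finite, 'k) mpol" where
  "Const c = Poly_Mapping.single 0 c"

definition Var :: "'v::finite \<Rightarrow> ('v, 'k::comm_ring_1) mpol" where
  "Var i = Poly_Mapping.single (Poly_Mapping.single i 1) 1"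

definition mon_degree :: "('v::finite \<Rightarrow>\<^sub>0 nat) \<Rightarrow> nat" where
  "mon_degree a = (\<Sum>i\<in>UNIV. Poly_Mapping.lookup a i)"

text \<open>The zero polynomial gets degree 0.\<close>

definition total_degree :: "('v::finite, 'k::comm_ring_1) mpol \<Rightarrow> nat" where
  "total_degree p = Max (insert 0 (mon_degree ` Poly_Mapping.keys p))"

definition is_form :: "('v::finite, 'k::comm_ring_1) mpol \<Rightarrow> bool" where
  "is_form p \<longleftrightarrow> (\<exists>d. \<forall>a\<in>Poly_Mapping.keys p. mon_degree a = d)"

text \<open>The subtraction of exponents is truncated, but if the exponent of the indeterminate is 0
  then so is the coefficient of the term.\<close>

definition pdiff :: "'v::finite \<Rightarrow> ('v, 'k::comm_ring_1) mpol \<Rightarrow> ('v, 'k) mpol" where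
  "pdiff i p = (\<Sum>a\<in>Poly_Mapping.keys p.
     Poly_Mapping.single (a - Poly_Mapping.single i 1)
       (of_nat (Poly_Mapping.lookup a i) * Poly_Mapping.lookup p a))"

text \<open>The value of $F \in k[T_1,\dots,T_m]$ under the $k$-algebra map sending $T_j$ to $f_j$.\<close>

definition subst :: "('v::finite, 'k::comm_ring_1) mpol ^ 'm::finite \<Rightarrow> ('m, 'k) mpol \<Rightarrow> ('v, 'k) mpol"
  where "subst f F = (\<Sum>a\<in>Poly_Mapping.keys F.
     Const (Poly_Mapping.lookup F a) * (\<Prod>j\<in>UNIV. f $ j ^ Poly_Mapping.lookup a j))"


subsection \<open>Free modules and short exact sequences\<close>

text \<open>The free module $R^m$ is \<^typ>\<open>'r ^ 'm\<close>, with basis \<^term>\<open>axis j 1\<close> (written $dT_j$ or $dx_i$ in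
  the two cases of interest).\<close>

global_interpretation rvec: module "(*s) :: 'r::comm_ring_1 \<Rightarrow> 'r ^ 'm::finite \<Rightarrow> 'r ^ 'm"
  by unfold_locales (vector algebra_simps)+

text \<open>Homomorphisms between submodules of free modules; nothing is required of the map off its
  domain.\<close>

definition submodule_hom ::
  "('r::comm_ring_1 ^ 'a::finite) set \<Rightarrow> ('r ^ 'b::finite) set \<Rightarrow> ('r ^ 'a \<Rightarrow> 'r ^ 'b) \<Rightarrow> bool" where
  "submodule_hom A B \<phi> \<longleftrightarrow> rvec.subspace A \<and> rvec.subspace B \<and> \<phi> ` A \<subseteq> B \<and>
     (\<forall>u\<in>A. \<forall>v\<in>A. \<phi> (u + v) = \<phi> u + \<phi> v) \<and> (\<forall>r. \<forall>u\<in>A. \<phi> (r *s u) = r *s \<phi> u)"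

text \<open>Exactness of $0 \to A \to B \to C \to 0$ with maps $\phi$ and $\psi$.\<close>

definition short_exact ::
  "('r::comm_ring_1 ^ 'a::finite) set \<Rightarrow> ('r ^ 'a \<Rightarrow> 'r ^ 'b::finite) \<Rightarrow> ('r ^ 'b) set \<Rightarrow>
   ('r ^ 'b \<Rightarrow> 'r ^ 'c::finite) \<Rightarrow> ('r ^ 'c) set \<Rightarrow> bool" where
  "short_exact A \<phi> B \<psi> C \<longleftrightarrow> submodule_hom A B \<phi> \<and> submodule_hom B C \<psi> \<and>
     inj_on \<phi> A \<and> \<phi> ` A = {b\<in>B. \<psi> b = 0} \<and> \<psi> ` B = C"


subsection \<open>Syzygies and differentials\<close>

definition syzygies :: "'r::comm_ring_1 ^ 'm::finite \<Rightarrow> ('r ^ 'm) set" where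
  "syzygies h = {g. (\<Sum>j\<in>UNIV. g $ j * h $ j) = 0}"

definition vars :: "('n::finite, 'k::comm_ring_1) mpol ^ 'n" where
  "vars = (\<chi> i. Var i)"

definition differential :: "('n::finite, 'k::comm_ring_1) mpol \<Rightarrow> ('n, 'k) mpol ^ 'n" where
  "differential p = (\<chi> i. pdiff i p)"

text \<open>The $R$-linear map sending $dT_j$ to $df_j$.\<close>

definition diff_map ::
  "('n::finite, 'k::comm_ring_1) mpol ^ 'm::finite \<Rightarrow> ('n, 'k) mpol ^ 'm \<Rightarrow> ('n, 'k) mpol ^ 'n" where
  "diff_map f g = (\<Sum>j\<in>UNIV. g $ j *s differential (f $ j))"

definition jacobian_module ::
  "('n::finite, 'k::comm_ring_1) mpol ^ 'm::finite \<Rightarrow> (('n, 'k) mpol ^ 'n) set" where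
  "jacobian_module f = rvec.span {differential (f $ j) | j. True}"

definition differential_syzygies ::
  "('n::finite, 'k::comm_ring_1) mpol ^ 'm::finite \<Rightarrow> (('n, 'k) mpol ^ 'm) set" where
  "differential_syzygies f = {g. diff_map f g = 0}"

definition polynomial_relations ::
  "('n::finite, 'k::comm_ring_1) mpol ^ 'm::finite \<Rightarrow> ('m, 'k) mpol set" where
  "polynomial_relations f = {F. subst f F = 0}"

definition polar_syzygies ::
  "('n::finite, 'k::comm_ring_1) mpol ^ 'm::finite \<Rightarrow> (('n, 'k) mpol ^ 'm) set" where
  "polar_syzygies f = rvec.span {\<chi> j. subst f (pdiff j F) | F. F \<in> polynomial_relations f}"

definition polarizable :: "('n::finite, 'k::comm_ring_1) mpol ^ 'm::finite \<Rightarrow> bool" where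
  "polarizable f \<longleftrightarrow> polar_syzygies f = differential_syzygies f"

text \<open>The family $d_1 f_1, \dots, d_m f_m$ with $d_j = \deg f_j$.\<close>

definition degree_scaled ::
  "('n::finite, 'k::comm_ring_1) mpol ^ 'm::finite \<Rightarrow> ('n, 'k) mpol ^ 'm" where
  "degree_scaled f = (\<chi> j. of_nat (total_degree (f $ j)) * f $ j)"

end

theory Submission
  imports Defs
begin

text \<open>Contracting a vector of \<open>\<Sum> R dx\<^sub>i\<close> with \<open>x\<close>, that is \<open>dx\<^sub>i \<mapsto> x\<^sub>i\<close>, sends \<open>df\<close> to
  \<open>deg f \<cdot> f\<close> for every form \<open>f\<close>, by Euler's identity (\<open>euler_identity\<close>). Composing
  \<open>dT\<^sub>j \<mapsto> df\<^sub>j\<close> with this contraction therefore gives \<open>dT\<^sub>j \<mapsto> d\<^sub>j f\<^sub>j\<close>, whose kernel is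
  the module of syzygies of \<open>d\<^sub>1 f\<^sub>1, \<dots>, d\<^sub>m f\<^sub>m\<close>. So these syzygies are precisely the preimage of
  \<open>Z(x)\<close> under \<open>dT\<^sub>j \<mapsto> df\<^sub>j\<close> (\<open>diff_map_mem_syzygies_vars_iff\<close>), and the sequence is the
  restriction of \<open>0 \<rightarrow> \<ZZ> \<rightarrow> R\<^sup>m \<rightarrow> D(f) \<rightarrow> 0\<close>, exact by the definition of its terms, to the
  preimage of the submodule \<open>D(f) \<inter> Z(x)\<close>. Polarizability merely renames the kernel.\<close>

text \<open>Multiplication by \<open>x\<^sub>i\<close> undoes the lowering of the exponent of \<open>x\<^sub>i\<close>; where the exponent is 0
  and the subtraction truncates, both sides vanish.\<close>

lemma pdiff_term_times_Var:
  fixes c :: "'k::comm_ring_1" and i :: "'v::finite"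
  shows "Poly_Mapping.single (a - Poly_Mapping.single i 1) (of_nat (Poly_Mapping.lookup a i) * c) * Var i
    = of_nat (Poly_Mapping.lookup a i) * Poly_Mapping.single a c"
proof (cases "Poly_Mapping.lookup a i = 0")
  case False
  then have "a - Poly_Mapping.single i 1 + Poly_Mapping.single i 1 = a"
    by (intro poly_mapping_eqI) (auto simp: lookup_add lookup_minus lookup_single when_def)
  then show ?thesis
    by (simp add: Var_def mult_single flip: single_of_nat)
qed simp

lemma total_degree_of_homogeneous:
  assumes "is_form p" and "a \<in> Poly_Mapping.keys p"
  shows "total_degree p = mon_degree a"
proof -
  have "mon_degree ` Poly_Mapping.keys p = {mon_degree a}"
    using assms unfolding is_form_def by force
  then show ?thesis
    by (simp add: total_degree_def)
qed

text \<open>Both sides are additive, and on a monomial with exponent vector \<open>a\<close> the left-hand side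
  multiplies by \<open>\<Sum> a\<^sub>i\<close>, which homogeneity makes the same number for all terms.\<close>

lemma euler_identity:
  fixes p :: "('n::finite, 'k::comm_ring_1) mpol"
  assumes "is_form p"
  shows "(\<Sum>i\<in>UNIV. pdiff i p * Var i) = of_nat (total_degree p) * p"
proof -
  let ?K = "Poly_Mapping.keys p"
  let ?t = "\<lambda>a. Poly_Mapping.single a (Poly_Mapping.lookup p a)"
  have "(\<Sum>i\<in>UNIV. pdiff i p * Var i)
      = (\<Sum>i\<in>UNIV. \<Sum>a\<in>?K. of_nat (Poly_Mapping.lookup a i) * ?t a)"
    unfolding pdiff_def sum_distrib_right pdiff_term_times_Var ..
  also have "\<dots> = (\<Sum>a\<in>?K. of_nat (mon_degree a) * ?t a)"
    by (subst sum.swap) (simp add: mon_degree_def sum_distrib_right)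
  also have "\<dots> = of_nat (total_degree p) * (\<Sum>a\<in>?K. ?t a)"
    by (simp add: sum_distrib_left total_degree_of_homogeneous[OF assms])
  also have "(\<Sum>a\<in>?K. ?t a) = p"
    by (rule poly_mapping_eqI)
      (simp add: lookup_sum lookup_single when_def in_keys_iff)
  finally show ?thesis .
qed

lemma diff_map_mem_syzygies_vars_iff:
  fixes f :: "('n::finite, 'k::comm_ring_1) mpol ^ 'm::finite"
  assumes "\<And>j. is_form (f $ j)"
  shows "diff_map f g \<in> syzygies vars \<longleftrightarrow> g \<in> syzygies (degree_scaled f)"
proof -
  have "(\<Sum>i\<in>UNIV. diff_map f g $ i * vars $ i)
      = (\<Sum>i\<in>UNIV. \<Sum>j\<in>UNIV. g $ j * (pdiff i (f $ j) * Var i))"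
    by (simp add: diff_map_def vars_def differential_def sum_distrib_right mult.assoc)
  also have "\<dots> = (\<Sum>j\<in>UNIV. g $ j * (\<Sum>i\<in>UNIV. pdiff i (f $ j) * Var i))"
    by (subst sum.swap) (simp add: sum_distrib_left)
  also have "\<dots> = (\<Sum>j\<in>UNIV. g $ j * degree_scaled f $ j)"
    by (simp add: degree_scaled_def euler_identity[OF assms])
  finally show ?thesis
    by (simp add: syzygies_def)
qed

lemma diff_map_add: "diff_map f (u + v) = diff_map f u + diff_map f v"
  by (simp add: diff_map_def rvec.scale_left_distrib sum.distrib)

lemma diff_map_scale: "diff_map f (r *s u) = r *s diff_map f u"
  by (simp add: diff_map_def rvec.scale_sum_right)

lemma diff_map_zero: "diff_map f 0 = 0"
  by (simp add: diff_map_def)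

lemma range_diff_map: "range (diff_map f) = jacobian_module f"
proof
  show "range (diff_map f) \<subseteq> jacobian_module f"
    unfolding jacobian_module_def diff_map_def
    by (blast intro: rvec.span_sum rvec.span_scale rvec.span_base)
next
  have "rvec.subspace (range (diff_map f))"
    unfolding rvec.subspace_def
    by (auto simp: image_iff) (metis diff_map_zero diff_map_add diff_map_scale)+
  moreover have "differential (f $ j) = diff_map f (axis j 1)" for j
    by (simp add: diff_map_def axis_def if_distrib[of "\<lambda>r. r *s _"] cong: if_cong)
  ultimately show "jacobian_module f \<subseteq> range (diff_map f)"
    unfolding jacobian_module_def by (intro rvec.span_minimal) auto
qed

lemma subspace_syzygies: "rvec.subspace (syzygies h)"
  unfolding rvec.subspace_def syzygies_def
  by (auto simp: distrib_right sum.distrib mult.assoc simp flip: sum_distrib_left)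

lemma subspace_differential_syzygies: "rvec.subspace (differential_syzygies f)"
  unfolding rvec.subspace_def differential_syzygies_def
  by (simp add: diff_map_zero diff_map_add diff_map_scale)

theorem proposition4p1:
  fixes f :: "('n::finite, 'k::field_char_0) mpol ^ 'm::finite"
  assumes forms: "\<And>j. is_form (f $ j)"
  shows "short_exact (differential_syzygies f) (\<lambda>g. g) (syzygies (degree_scaled f))
           (diff_map f) (jacobian_module f \<inter> syzygies vars) \<and>
         (polarizable f \<longrightarrow>
           short_exact (polar_syzygies f) (\<lambda>g. g) (syzygies (degree_scaled f))
             (diff_map f) (jacobian_module f \<inter> syzygies vars))"
proof -
  note preimage = diff_map_mem_syzygies_vars_iff[OF forms]
  have image: "diff_map f ` syzygies (degree_scaled f) = jacobian_module f \<inter> syzygies vars"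
    unfolding range_diff_map[symmetric] using preimage by blast
  \<comment> \<open>A differential syzygy maps to \<open>0 \<in> Z(x)\<close>, hence lies in the preimage of \<open>Z(x)\<close>.\<close>
  have subset: "differential_syzygies f \<subseteq> syzygies (degree_scaled f)"
    using preimage rvec.subspace_0[OF subspace_syzygies]
    by (metis (mono_tags, lifting) differential_syzygies_def mem_Collect_eq subsetI)
  then have kernel: "differential_syzygies f = {g \<in> syzygies (degree_scaled f). diff_map f g = 0}"
    by (auto simp: differential_syzygies_def)
  have "rvec.subspace (jacobian_module f \<inter> syzygies vars)"
    unfolding jacobian_module_def
    by (intro rvec.subspace_inter rvec.subspace_span subspace_syzygies)
  then have "submodule_hom (syzygies (degree_scaled f)) (jacobian_module f \<inter> syzygies vars) (diff_map f)"
    using image by (simp add: submodule_hom_def subspace_syzygies diff_map_add diff_map_scale)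
  moreover have "submodule_hom (differential_syzygies f) (syzygies (degree_scaled f)) (\<lambda>g. g)"
    using subset by (auto simp: submodule_hom_def subspace_syzygies subspace_differential_syzygies)
  ultimately have "short_exact (differential_syzygies f) (\<lambda>g. g) (syzygies (degree_scaled f))
      (diff_map f) (jacobian_module f \<inter> syzygies vars)"
    using image kernel by (simp add: short_exact_def)
  then show ?thesis
    by (simp add: polarizable_def)
qed

end
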